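(* Let $m\ge 4$ be even and $n=(3^m-1)/2$. For each $0\le i\le (m-2)/2$ let $\Xi_i=\{i,\,m-1-i\}$ and choose $j_i\in\Xi_i$. Let $\mathcal{S}_4(\mathcal{C})$ be the ternary negacyclic code of length $n$ with defining set $$Z=T_{(3,m,j_0)}\cup T_{(3,m,j_1)}\cup\cdots\cup T_{(3,m,j_{(m-2)/2})}.$$ Then $\mathcal{S}_4(\mathcal{C})$ is a self-dual code of length $(3^m-1)/2$ and dimension $(3^m-1)/4$ whose minimum distance is at least $d$, where $$d=\begin{cases}3^{(m-2)/2}+3 & \text{if } m\equiv 0\pmod 4,\\ 3^{(m-4)/2}+3 & \text{if } m\equiv 2\pmod 4.\end{cases}$$
   Context: Let $N=3^m-1$, $n=N/2$. For $0\le i\le 3^m-1$ with $3$-adic expansion $i=\sum_{j=0}^{m-1}i_j3^j$, $0\le i_j\le 2$, let $\mathtt{wt}_3(i)=i_0+\cdots+i_{m-1}$. For $0\le\ell\le m-1$ let $T_{(3,m,\ell)}=\{i\in\{0,1,\dots,N-1\}:\mathtt{wt}_3(i)=1+2\ell\}$; this set is closed under multiplication by $3$ modulo $N$ and consists of odd integers. A linear code of length $n$ over $\mathrm{GF}(3)$ is negacyclic if, under $(c_0,\dots,c_{n-1})\mapsto\sum_jc_jx^j$, it is an ideal of $\mathrm{GF}(3)[x]/(x^n+1)$; its generator polynomial is the monic divisor of $x^n+1$ generating it. Fix a primitive element $\beta$ of $\mathrm{GF}(3^m)$, so $\beta^n=-1$ and the roots of $x^n+1$ are $\beta^i$ with $i$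 odd. The negacyclic code with defining set $Z$ is the one with generator polynomial $\prod_{i\in Z}(x-\beta^i)$. Self-dual means equal to its dual under the standard (Euclidean) inner product; minimum distance is Hamming distance. *)

theory Defs
  imports
    "HOL-Library.Numeral_Type"
    "HOL-Algebra.QuotRing"
    "Berlekamp_Zassenhaus.Finite_Field"
    "Jordan_Normal_Form.VS_Connect"
begin

section \<open>The field with three elements\<close>

text \<open>
  The numeral type \<open>3\<close> abbreviates \<open>num1 bit1\<close>, and \<open>'a bit1\<close> has three elements exactly when
  \<open>'a\<close> has one; hence the sort \<open>CARD_1\<close> in the arity below.
\<close>

instance bit1 :: (CARD_1) prime_card
proof
  have "CARD('a bit1) = 3"
    by (simp add: card_bit1 CARD_1)
  then show "prime CARD('a bit1)"
    by simp
qed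

type_synonym gf3 = "3 mod_ring"

text \<open>
  Into a ring of characteristic 3 this is the unique ring homomorphism, i.e. the inclusion of the
  prime field.
\<close>

definition gf3_embed :: "gf3 \<Rightarrow> 'f::ring_1" where
  "gf3_embed x = of_int (to_int_mod_ring x)"

definition primitive_element :: "'f::field \<Rightarrow> bool" where
  "primitive_element \<beta> \<longleftrightarrow> \<beta> \<noteq> 0 \<and> (\<forall>x. x \<noteq> 0 \<longrightarrow> (\<exists>k::nat. x = \<beta> ^ k))"

section \<open>Linear codes\<close>

definition linear_code :: "nat \<Rightarrow> 'a::field vec set \<Rightarrow> bool" where
  "linear_code n C \<longleftrightarrow> VectorSpace.subspace class_ring C (module_vec TYPE('a) n)"

definition code_dim :: "nat \<Rightarrow> 'a::field vec set \<Rightarrow> nat" where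
  "code_dim n C = vectorspace.dim class_ring ((module_vec TYPE('a) n)\<lparr>carrier := C\<rparr>)"

definition dual_code :: "nat \<Rightarrow> 'a::field vec set \<Rightarrow> 'a vec set" where
  "dual_code n C = {v \<in> carrier_vec n. \<forall>c\<in>C. v \<bullet> c = 0}"

definition self_dual :: "nat \<Rightarrow> 'a::field vec set \<Rightarrow> bool" where
  "self_dual n C \<longleftrightarrow> C = dual_code n C"

definition hamming_dist :: "'a vec \<Rightarrow> 'a vec \<Rightarrow> nat" where
  "hamming_dist u v = card {i. i < dim_vec u \<and> u $ i \<noteq> v $ i}"

definition min_distance :: "'a vec set \<Rightarrow> nat" where
  "min_distance C = Inf {hamming_dist u v | u v. u \<in> C \<and> v \<in> C \<and> u \<noteq> v}"

section \<open>Negacyclic codes\<close>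

definition negacyclic_modulus :: "nat \<Rightarrow> 'a::field poly set" where
  "negacyclic_modulus n = genideal class_ring {monom 1 n + 1}"

definition negacyclic_ring :: "nat \<Rightarrow> 'a::field poly set ring" where
  "negacyclic_ring n = class_ring Quot (negacyclic_modulus n)"

definition residue_class :: "nat \<Rightarrow> 'a::field poly \<Rightarrow> 'a poly set" where
  "residue_class n p = negacyclic_modulus n +>\<^bsub>class_ring\<^esub> p"

definition code_residues :: "nat \<Rightarrow> 'a::field vec set \<Rightarrow> 'a poly set set" where
  "code_residues n C = (\<lambda>c. residue_class n (Poly (list_of_vec c))) ` C"

definition negacyclic_code :: "nat \<Rightarrow> 'a::field vec set \<Rightarrow> bool" where
  "negacyclic_code n C \<longleftrightarrow>
     linear_code n C \<and> ideal (code_residues n C) (negacyclic_ring n)"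

definition generator_polynomial :: "nat \<Rightarrow> 'a::field vec set \<Rightarrow> 'a poly \<Rightarrow> bool" where
  "generator_polynomial n C g \<longleftrightarrow>
     lead_coeff g = 1 \<and> g dvd monom 1 n + 1 \<and>
     code_residues n C = genideal (negacyclic_ring n) {residue_class n g}"

text \<open>
  The product over the defining set is formed over the extension field; it equals the image of
  the generator polynomial, whose coefficients lie in GF(3).
\<close>

definition negacyclic_code_of :: "nat \<Rightarrow> 'f::field \<Rightarrow> nat set \<Rightarrow> gf3 vec set" where
  "negacyclic_code_of n \<beta> Z =
     (THE C. negacyclic_code n C \<and>
        (\<exists>g. generator_polynomial n C g \<and>
             map_poly gf3_embed g = (\<Prod>i\<in>Z. [:- (\<beta> ^ i), 1:])))"

section \<open>The defining sets\<close>

definition wt3 :: "nat \<Rightarrow> nat \<Rightarrow> nat" where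
  "wt3 m i = (\<Sum>j<m. (i div 3 ^ j) mod 3)"

definition T3 :: "nat \<Rightarrow> nat \<Rightarrow> nat set" where
  "T3 m l = {i. i < 3 ^ m - 1 \<and> wt3 m i = 1 + 2 * l}"

end

theory Submission
  imports Defs
begin

text \<open>
  Since \<open>wt3 m (3 ^ m - 1 - i) = 2 * m - wt3 m i\<close>, negation of exponents maps \<open>T3 m l\<close> to
  \<open>T3 m (m - 1 - l)\<close>, so \<open>Z\<close> and \<open>- Z\<close> partition the odd residues.  Parseval's identity for the Fourier
  transform over the odd powers of \<open>\<beta>\<close> then makes the code self-orthogonal, and counting makes it
  self-dual.  In particular all its weights are divisible by 3.

  For the distance, the numbers \<open>3 ^ r - 1 + 3 ^ (2 * r) * u + t * (3 ^ r - 1)\<close> with \<open>t < 3 ^ r\<close> form an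
  arithmetic progression of constant weight \<open>2 * r + wt3 (m - 2 * r) u\<close>.  Whichever of the sets
  \<open>T3 m (m / 2 - 1)\<close> and \<open>T3 m (m / 2)\<close> was chosen, \<open>u\<close> can be adjusted so that the
  progression lies in it, for \<open>r = m / 2 - 1\<close> when 4 divides \<open>m\<close> and \<open>r = m / 2 - 2\<close> otherwise; these
  choices make \<open>r\<close> coprime to \<open>m\<close>, which is what the BCH argument needs.  It gives weight at least \<open>3 ^ r + 1\<close>, hence \<open>3 ^ r + 3\<close> by divisibility.
\<close>

section \<open>Ternary digit sums\<close>

lemma wt3_0 [simp]: "wt3 0 i = 0"
  by (simp add: wt3_def)

lemma wt3_Suc: "wt3 (Suc m) i = i mod 3 + wt3 m (i div 3)"
  unfolding wt3_def by (simp only: sum.lessThan_Suc_shift) (simp add: div_mult2_eq)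

text \<open>No carry occurs: the digits of \<open>y\<close> are placed above the lowest
  \<open>a\<close> positions, which hold those of \<open>x\<close>.\<close>

lemma wt3_append:
  assumes "x < 3 ^ a"
  shows "wt3 (a + b) (x + 3 ^ a * y) = wt3 a x + wt3 b y"
  using assms
proof (induction a arbitrary: x)
  case (Suc a)
  have "x div 3 < 3 ^ a" using Suc.prems by auto
  moreover have "(x + 3 ^ Suc a * y) div 3 = x div 3 + 3 ^ a * y" by simp
  moreover have "(x + 3 ^ Suc a * y) mod 3 = x mod 3" by (simp add: mult.assoc)
  ultimately show ?case
    using Suc.IH by (simp add: wt3_Suc)
qed simp

text \<open>All digits of \<open>3 ^ m - 1\<close> are 2, so the subtraction never borrows and turns
  each digit d into 2 - d.\<close>

lemma wt3_complement:
  assumes "i < 3 ^ m"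
  shows "wt3 m (3 ^ m - 1 - i) + wt3 m i = 2 * m"
  using assms
proof (induction m arbitrary: i)
  case (Suc m)
  define q r where "q = i div 3" and "r = i mod 3"
  have i: "i = 3 * q + r" and r: "r < 3" by (auto simp: q_def r_def)
  have q: "q < 3 ^ m" using Suc.prems by (auto simp: q_def)
  have c: "3 ^ Suc m - 1 - i = 3 * (3 ^ m - 1 - q) + (2 - r)"
    using i r q by (simp add: algebra_simps)
  have "(3 * a + b) div 3 = a" "(3 * a + b) mod 3 = b" if "b < 3" for a b :: nat
    using that by auto
  from this[of "2 - r" "3 ^ m - 1 - q"]
  have "(3 ^ Suc m - 1 - i) div 3 = 3 ^ m - 1 - q" "(3 ^ Suc m - 1 - i) mod 3 = 2 - r"
    unfolding c using r by auto
  then show ?case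
    using Suc.IH[OF q] r by (simp add: wt3_Suc flip: q_def r_def)
qed simp

lemma wt3_le: "wt3 m i \<le> 2 * m"
proof -
  have "x mod 3 \<le> 2" for x :: nat by presburger
  then have "wt3 m i \<le> (\<Sum>j<m. 2)"
    unfolding wt3_def by (intro sum_mono) blast
  then show ?thesis by simp
qed

text \<open>Powers of 3 are odd, so a number and its ternary digit sum agree modulo 2.\<close>

lemma even_wt3:
  assumes "i < 3 ^ m"
  shows "even (wt3 m i) \<longleftrightarrow> even i"
  using assms
proof (induction m arbitrary: i)
  case (Suc m)
  have "even (wt3 m (i div 3)) \<longleftrightarrow> even (i div 3)"
    using Suc.prems by (intro Suc.IH) auto
  moreover have "even i \<longleftrightarrow> even (i mod 3 + i div 3)" by presburger
  ultimately show ?case by (simp add: wt3_Suc)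
qed simp

text \<open>A cyclic shift of the digits: the top digit \<open>i div 3 ^ m\<close> moves to the
  lowest place.\<close>

lemma wt3_rotate:
  assumes "i < 3 ^ Suc m"
  shows "wt3 (Suc m) (3 * (i mod 3 ^ m) + i div 3 ^ m) = wt3 (Suc m) i"
proof -
  define x y where "x = i mod 3 ^ m" and "y = i div 3 ^ m"
  have i: "i = x + 3 ^ m * y" and x: "x < 3 ^ m" by (auto simp: x_def y_def)
  have y: "y < 3 ^ 1" using assms by (auto simp: y_def less_mult_imp_div_less)
  have "wt3 (Suc m) i = wt3 m x + wt3 1 y"
    unfolding i using wt3_append[OF x, of 1 y] by simp
  moreover have "wt3 (Suc m) (3 * x + y) = wt3 1 y + wt3 m x"
    using wt3_append[OF y, of m x] by (simp add: add.commute)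
  ultimately show ?thesis by (simp flip: x_def y_def)
qed

text \<open>
  The digits of \<open>t\<close> and of \<open>3 ^ r - 1 - t\<close> are complementary, so the weight does not depend on \<open>t\<close>
  although the number is an affine function of \<open>t\<close>.
\<close>

lemma wt3_progression:
  assumes t: "t < 3 ^ r"
  shows "wt3 (r + (r + s)) (3 ^ r - 1 + 3 ^ r * 3 ^ r * u + t * (3 ^ r - 1)) = 2 * r + wt3 s u"
proof -
  obtain k where k: "(3::nat) ^ r = Suc (t + k)" using less_imp_Suc_add[OF t] by blast
  have less: "3 ^ r - 1 - t < (3::nat) ^ r" unfolding k by simp
  \<comment> \<open>Collecting multiples of \<open>3 ^ r\<close> exhibits three digit blocks: the
    complement of \<open>t\<close>, then \<open>t\<close>, then \<open>u\<close>.\<close>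
  have "3 ^ r - 1 + 3 ^ r * 3 ^ r * u + t * (3 ^ r - 1) = (3 ^ r - 1 - t) + 3 ^ r * (t + 3 ^ r * u)"
    unfolding k by (simp add: algebra_simps)
  then have "wt3 (r + (r + s)) (3 ^ r - 1 + 3 ^ r * 3 ^ r * u + t * (3 ^ r - 1))
      = wt3 r (3 ^ r - 1 - t) + (wt3 r t + wt3 s u)"
    by (simp only: wt3_append[OF less] wt3_append[OF t])
  then show ?thesis using wt3_complement[OF t] by linarith
qed

text \<open>Since \<open>(3 ^ r - 1) * (t + 1) < 3 ^ r * 3 ^ r\<close>, the part without
  \<open>u\<close> fits into the lowest \<open>2 * r\<close> digits.\<close>

lemma wt3_progression_less:
  assumes "t < 3 ^ r" and "u < 3 ^ s"
  shows "3 ^ r - 1 + 3 ^ r * 3 ^ r * u + t * (3 ^ r - 1) < (3::nat) ^ (r + (r + s))"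
proof -
  obtain k where k: "(3::nat) ^ r = Suc k"
    by (metis gr0_conv_Suc zero_less_numeral zero_less_power)
  have "t * k \<le> k * k" using assms(1) by (intro mult_right_mono) (auto simp: k)
  then have "k + t * k < Suc k * Suc k" unfolding mult_Suc mult_Suc_right by linarith
  moreover have "Suc k * Suc k * (u + 1) \<le> Suc k * Suc k * 3 ^ s"
    using assms(2) by (intro mult_left_mono) auto
  ultimately have "k + t * k + Suc k * Suc k * u < Suc k * Suc k * 3 ^ s"
    unfolding distrib_left by linarith
  then show ?thesis by (simp only: power_add k mult.assoc diff_Suc_1)
qed

section \<open>The sets \<open>T3\<close> under negation and multiplication by 3\<close>

lemma mem_T3_complement:
  assumes "0 < i" and "i < 3 ^ m - 1" and "l < m"
  shows "3 ^ m - 1 - i \<in> T3 m (m - 1 - l) \<longleftrightarrow> i \<in> T3 m l"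
proof -
  have "i < 3 ^ m" using assms by (simp add: less_diff_conv)
  from wt3_complement[OF this] assms show ?thesis unfolding T3_def by auto
qed

lemma odd_in_T3:
  assumes "odd i" and "i < 3 ^ m - 1"
  obtains l where "l < m" and "i \<in> T3 m l"
proof -
  have "odd (wt3 m i)" using even_wt3[of i m] assms by simp
  then obtain l where l: "wt3 m i = 1 + 2 * l" by (auto elim: oddE)
  then have "l < m" using wt3_le[of m i] by linarith
  with l assms that show thesis unfolding T3_def by blast
qed

lemma T3_odd: "i \<in> T3 m l \<Longrightarrow> odd i"
proof -
  assume i: "i \<in> T3 m l"
  then have "i < 3 ^ m" by (simp add: T3_def less_diff_conv)
  from even_wt3[OF this] i show ?thesis by (simp add: T3_def)
qed

lemma T3_disjoint: "i \<in> T3 m l \<Longrightarrow> i \<in> T3 m k \<Longrightarrow> l = k"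
  by (auto simp: T3_def)

text \<open>The pairs of \<open>i\<close> and \<open>2 * k - 1 - i\<close> with \<open>i < k\<close>
  partition the numbers below \<open>2 * k\<close>, and \<open>j\<close> picks exactly one member of
  each.\<close>

lemma choice_complement:
  fixes j :: "nat \<Rightarrow> nat"
  assumes j: "\<And>i. i < k \<Longrightarrow> j i = i \<or> j i = 2 * k - 1 - i" and "l < 2 * k"
  shows "2 * k - 1 - l \<in> j ` {..<k} \<longleftrightarrow> l \<notin> j ` {..<k}"
proof -
  \<comment> \<open>The lower half is treated directly; exchanging \<open>l\<close> and
    \<open>2 * k - 1 - l\<close> yields the upper half.\<close>
  have main: "2 * k - 1 - l \<in> j ` {..<k} \<longleftrightarrow> l \<notin> j ` {..<k}" if l: "l < k" for l
  proof -
    have *: "x \<in> j ` {..<k} \<longleftrightarrow> j l = x" if x: "x = l \<or> x = 2 * k - 1 - l" for x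
    proof
      assume "x \<in> j ` {..<k}"
      then obtain i where i: "i < k" "x = j i" by blast
      have "i = l" using j[OF i(1)] i l x by linarith
      then show "j l = x" using i by simp
    qed (use l in blast)
    have "l \<noteq> 2 * k - 1 - l" using l by linarith
    then show ?thesis using j[OF l] *[of l] *[of "2 * k - 1 - l"] by argo
  qed
  show ?thesis
  proof (cases "l < k")
    case False
    then have "2 * k - 1 - l < k" and eq: "2 * k - 1 - (2 * k - 1 - l) = l"
      using \<open>l < 2 * k\<close> by linarith+
    from main[OF this(1)] show ?thesis unfolding eq by blast
  qed (rule main)
qed

lemma T3_less: "i \<in> T3 m l \<Longrightarrow> i < 3 ^ m - 1"
  by (simp add: T3_def)

text \<open>\<open>3 ^ m - 1\<close> is even, so an odd digit sum already excludes it from the range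
  \<open>i < 3 ^ m\<close>.\<close>

lemma mem_T3I:
  assumes "i < 3 ^ m" and "wt3 m i = 1 + 2 * l"
  shows "i \<in> T3 m l"
proof -
  have "odd i" using even_wt3[OF assms(1)] assms(2) by simp
  then have "i \<noteq> 3 ^ m - 1" by auto
  with assms show ?thesis by (simp add: T3_def)
qed

text \<open>Modulo \<open>3 ^ m - 1\<close> the power \<open>3 ^ m\<close> is 1, so multiplication
  by 3 rotates the digits; \<open>y\<close> is the top digit carried around.\<close>

lemma T3_rotate:
  assumes "0 < m" and "i \<in> T3 m l"
  obtains k y where "k \<in> T3 m l" and "3 * i = k + (3 ^ m - 1) * y"
proof -
  obtain m' where m: "m = Suc m'" using assms(1) by (auto dest: gr0_implies_Suc)
  define x y where "x = i mod 3 ^ m'" and "y = i div 3 ^ m'"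
  have i: "i = x + 3 ^ m' * y" and x: "x < 3 ^ m'" by (auto simp: x_def y_def)
  have "i < 3 ^ m" using assms(2) by (simp add: T3_def less_diff_conv)
  then have y: "y < 3" unfolding m y_def by (simp add: less_mult_imp_div_less)
  have "wt3 m (3 * x + y) = wt3 m i"
    using wt3_rotate[of i m'] \<open>i < 3 ^ m\<close> by (simp add: m x_def y_def)
  moreover have "3 * x + y < 3 ^ m" unfolding m power_Suc using x y by linarith
  ultimately have "3 * x + y \<in> T3 m l" using assms(2) by (intro mem_T3I) (simp_all add: T3_def)
  moreover have "3 * i = 3 * x + y + (3 ^ m - 1) * y"
  proof -
    obtain M where M: "(3::nat) ^ m = Suc M" by (metis gr0_implies_Suc zero_less_numeral zero_less_power)
    have "3 * i = 3 * x + 3 ^ m * y" unfolding i m by simp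
    then show ?thesis unfolding M by simp
  qed
  ultimately show ?thesis by (rule that)
qed

lemma progression_in_T3:
  assumes "t < 3 ^ r" and "u < 3 ^ s" and "2 * r + wt3 s u = 1 + 2 * l"
  shows "3 ^ r - 1 + 3 ^ r * 3 ^ r * u + t * (3 ^ r - 1) \<in> T3 (r + (r + s)) l"
  using assms wt3_progression wt3_progression_less by (intro mem_T3I) simp_all

section \<open>Finite fields of characteristic 3\<close>

text \<open>Translation by 1 permutes the ring, so adding 1 to every element leaves the sum of all
  elements unchanged.\<close>

lemma of_nat_CARD_eq_0: "of_nat CARD('f) = (0 :: 'f :: {finite, ring_1})"
proof -
  have "(\<Sum>x\<in>UNIV. x) = (\<Sum>x\<in>UNIV. x + (1 :: 'f))"
    by (rule sum.reindex_bij_witness[of _ "\<lambda>x. x + 1" "\<lambda>x. x - 1"]) auto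
  also have "\<dots> = (\<Sum>x\<in>UNIV. x) + of_nat CARD('f)"
    by (simp add: sum.distrib)
  finally show ?thesis by simp
qed

lemma to_int_gf3_add: "to_int_mod_ring (x + y :: gf3) = (to_int_mod_ring x + to_int_mod_ring y) mod 3"
  by transfer simp

lemma to_int_gf3_mult: "to_int_mod_ring (x * y :: gf3) = (to_int_mod_ring x * to_int_mod_ring y) mod 3"
  by transfer simp

lemma field_hom_gf3_embed:
  assumes "(3 :: 'f :: field) = 0"
  shows "field_hom (gf3_embed :: gf3 \<Rightarrow> 'f)"
proof -
  have *: "of_int (a mod 3) = (of_int a :: 'f)" for a
  proof -
    have "(of_int a :: 'f) = of_int (3 * (a div 3) + a mod 3)" by simp
    also have "\<dots> = 3 * of_int (a div 3) + of_int (a mod 3)"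
      unfolding of_int_add of_int_mult by simp
    finally show ?thesis using assms by simp
  qed
  show ?thesis
    by unfold_locales (simp_all add: gf3_embed_def to_int_gf3_add to_int_gf3_mult *)
qed

lemma cube_add:
  assumes "(3 :: 'f :: field) = 0"
  shows "(x + y) ^ 3 = x ^ 3 + (y :: 'f) ^ 3"
proof -
  have "(x + y) ^ 3 = x ^ 3 + y ^ 3 + 3 * (x\<^sup>2 * y + x * y\<^sup>2)"
    by (simp add: power2_eq_square power3_eq_cube algebra_simps)
  then show ?thesis using assms by simp
qed

lemma field_hom_cube:
  assumes "(3 :: 'f :: field) = 0"
  shows "field_hom (\<lambda>x :: 'f. x ^ 3)"
  by unfold_locales (simp_all add: cube_add[OF assms] power_mult_distrib)

text \<open>The polynomial x^3 - x = x (x - 1) (x + 1) has only the roots 0, 1 and -1, all in the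
  prime field.\<close>

lemma cube_fixed_in_range:
  assumes "(3 :: 'f :: field) = 0" and "x ^ 3 = (x :: 'f)"
  shows "x \<in> range (gf3_embed :: gf3 \<Rightarrow> 'f)"
proof -
  interpret e: field_hom "gf3_embed :: gf3 \<Rightarrow> 'f" by (rule field_hom_gf3_embed[OF assms(1)])
  have "x * (x - 1) * (x + 1) = 0"
    using assms(2) by (simp add: power3_eq_cube algebra_simps)
  then have "x = 0 \<or> x = 1 \<or> x = -1" by (auto simp: eq_neg_iff_add_eq_0)
  then have "x = gf3_embed (0 :: gf3) \<or> x = gf3_embed (1 :: gf3) \<or> x = gf3_embed (- 1 :: gf3)"
    by (simp add: hom_distribs)
  then show ?thesis by blast
qed

lemma gf3_square: "x \<noteq> 0 \<Longrightarrow> x * x = (1 :: gf3)"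
proof -
  assume "x \<noteq> 0"
  have "to_int_mod_ring x \<in> {0..<3}"
    using range_to_int_mod_ring[where 'a = 3] by auto
  moreover have "to_int_mod_ring x \<noteq> 0" using \<open>x \<noteq> 0\<close> by simp
  ultimately have "to_int_mod_ring x = 1 \<or> to_int_mod_ring x = 2"
    unfolding atLeastLessThan_iff by linarith
  then consider "x = 1" | "to_int_mod_ring x = 2" by auto
  then show ?thesis
  proof cases
    case 2
    then have "to_int_mod_ring (x * x) = 1" by (simp add: to_int_gf3_mult)
    then show ?thesis by simp
  qed simp
qed

lemma of_nat_gf3_eq_0_iff: "of_nat k = (0 :: gf3) \<longleftrightarrow> 3 dvd k"
proof
  assume "3 dvd k"
  moreover have "(3 :: gf3) = 0" using of_nat_CARD_eq_0[where 'f = gf3] by simp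
  ultimately show "of_nat k = (0 :: gf3)" by (auto elim!: dvdE)
qed (use of_nat_0_mod_ring_dvd[where 'a = 3, of k] in simp)

text \<open>Elements fixed by Frobenius lie in the prime field, so a polynomial with
  Frobenius-invariant coefficients descends to GF(3).\<close>

lemma map_poly_gf3_embedE:
  assumes "(3 :: 'f :: field) = 0" and "map_poly (\<lambda>x. x ^ 3) p = (p :: 'f poly)"
  obtains g :: "gf3 poly" where "map_poly gf3_embed g = p"
proof
  interpret e: field_hom "gf3_embed :: gf3 \<Rightarrow> 'f" by (rule field_hom_gf3_embed[OF assms(1)])
  have "coeff p i ^ 3 = coeff p i" for i
    using assms(2) by (metis coeff_map_poly zero_power zero_less_numeral)
  then have "coeff p i \<in> range (gf3_embed :: gf3 \<Rightarrow> 'f)" for i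
    by (intro cube_fixed_in_range assms)
  then have *: "gf3_embed (inv_into UNIV gf3_embed (coeff p i) :: gf3) = coeff p i" for i
    by (rule f_inv_into_f)
  \<comment> \<open>\<open>coeff_map_poly\<close> applies only to maps that send 0 to 0.\<close>
  have "inv_into UNIV gf3_embed (0 :: 'f) = (0 :: gf3)"
    using e.inv_f_f[of 0] by (simp only: e.hom_zero)
  then show "map_poly gf3_embed (map_poly (inv_into UNIV gf3_embed) p :: gf3 poly) = p"
    by (intro poly_eqI) (simp add: coeff_map_poly *)
qed

text \<open>Roots are split off one at a time: a new \<open>a\<close> is not a root of the product
  over the earlier ones, hence it is a root of the cofactor.\<close>

lemma prod_roots_dvd:
  fixes p :: "'f :: field poly"
  assumes "finite A" and "\<And>a. a \<in> A \<Longrightarrow> poly p a = 0"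
  shows "(\<Prod>a\<in>A. [:- a, 1:]) dvd p"
  using assms
proof (induction A rule: finite_induct)
  case (insert a A)
  then obtain q where q: "p = (\<Prod>a\<in>A. [:- a, 1:]) * q" by (auto elim: dvdE)
  have "poly (\<Prod>a\<in>A. [:- a, 1:]) a \<noteq> 0"
    using insert.hyps by (auto simp: poly_prod)
  then have "poly q a = 0" using insert.prems[of a] by (auto simp: q)
  then have "[:- a, 1:] dvd q" by (simp add: poly_eq_0_iff_dvd)
  then show ?case
    unfolding q prod.insert[OF insert.hyps] by (subst mult.commute) (rule mult_dvd_mono[OF dvd_refl])
qed simp

lemma prod_roots_dvd_iff:
  fixes p :: "'f :: field poly"
  assumes "finite A"
  shows "(\<Prod>a\<in>A. [:- a, 1:]) dvd p \<longleftrightarrow> (\<forall>a\<in>A. poly p a = 0)"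
proof
  assume *: "(\<Prod>a\<in>A. [:- a, 1:]) dvd p"
  show "\<forall>a\<in>A. poly p a = 0"
  proof
    fix a assume "a \<in> A"
    then have "[:- a, 1:] dvd (\<Prod>a\<in>A. [:- a, 1:])" using assms by (intro dvd_prodI)
    with * show "poly p a = 0" by (meson dvd_trans poly_eq_0_iff_dvd)
  qed
qed (use prod_roots_dvd[OF assms] in blast)

text \<open>For the least positive \<open>e\<close> with \<open>\<beta> ^ e = 1\<close>, the powers
  below \<open>e\<close> are distinct and exhaust the nonzero elements, so \<open>e\<close> is their
  number.\<close>

lemma primitive_element_order:
  fixes \<beta> :: "'f :: {finite, field}"
  assumes "primitive_element \<beta>"
  shows "\<beta> ^ (CARD('f) - 1) = 1" and "inj_on (\<lambda>k. \<beta> ^ k) {..<CARD('f) - 1}"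
proof -
  have b: "\<beta> \<noteq> 0" and gen: "\<And>x. x \<noteq> 0 \<Longrightarrow> \<exists>k. x = \<beta> ^ k"
    using assms by (auto simp: primitive_element_def)
  have card: "card (UNIV - {0 :: 'f}) = CARD('f) - 1" by (simp add: card_Diff_singleton)
  have "\<not> inj (\<lambda>k :: nat. \<beta> ^ k)"
    using finite_imageD[of "\<lambda>k :: nat. \<beta> ^ k" UNIV] by auto
  then obtain a c where "a < c" "\<beta> ^ a = \<beta> ^ c"
    by (metis injI linorder_neqE_nat)
  then have "\<beta> ^ (c - a) = 1" "c - a > 0" using b by (auto simp: power_diff)
  then have ex: "\<exists>e. e > 0 \<and> \<beta> ^ e = 1" by blast
  define e where "e = (LEAST e. e > 0 \<and> \<beta> ^ e = 1)"
  have e: "e > 0" "\<beta> ^ e = 1" using LeastI_ex[OF ex] by (auto simp: e_def)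
  have least: "e \<le> k" if "k > 0" "\<beta> ^ k = 1" for k
    unfolding e_def by (rule Least_le) (use that in simp)
  have inj: "inj_on (\<lambda>k. \<beta> ^ k) {..<e}"
  proof (rule linorder_inj_onI)
    fix x y assume xy: "x < y" "x \<in> {..<e}" "y \<in> {..<e}"
    show "\<beta> ^ x \<noteq> \<beta> ^ y"
    proof
      assume "\<beta> ^ x = \<beta> ^ y"
      then have "\<beta> ^ (y - x) = 1" using b xy by (simp add: power_diff)
      then show False using least[of "y - x"] xy by auto
    qed
  qed auto
  have "(\<lambda>k. \<beta> ^ k) ` {..<e} = UNIV - {0}"
  proof (intro equalityI subsetI)
    fix x :: 'f assume "x \<in> UNIV - {0}"
    then have "x \<noteq> 0" by simp
    then obtain k where k: "x = \<beta> ^ k" using gen by blast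
    have "\<beta> ^ k = \<beta> ^ (e * (k div e) + k mod e)" by simp
    also have "\<dots> = \<beta> ^ (k mod e)" unfolding power_add power_mult e(2) by simp
    finally show "x \<in> (\<lambda>k. \<beta> ^ k) ` {..<e}" using k e(1) by auto
  qed (use b in auto)
  then have "e = CARD('f) - 1" using card card_image[OF inj] by simp
  then show "\<beta> ^ (CARD('f) - 1) = 1" "inj_on (\<lambda>k. \<beta> ^ k) {..<CARD('f) - 1}"
    using e inj by simp_all
qed

section \<open>Words as polynomials\<close>

declare coeff_Poly_eq [simp del] list_of_vec_vec [simp del]

abbreviation code_poly :: "'a :: zero vec \<Rightarrow> 'a poly" where
  "code_poly c \<equiv> Poly (list_of_vec c)"

text \<open>A concrete model of the ideal generated by \<open>g\<close>;
  \<open>negacyclic_code_of_eq\<close> identifies it with the code given by the definite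
  description.\<close>

definition generated_code :: "nat \<Rightarrow> 'a :: field poly \<Rightarrow> 'a vec set" where
  "generated_code n g = {c \<in> carrier_vec n. g dvd code_poly c}"

lemma coeff_code_poly: "coeff (code_poly c) i = (if i < dim_vec c then c $ i else 0)"
  by (simp add: coeff_Poly_eq nth_default_def)

lemma degree_code_poly: "c \<in> carrier_vec n \<Longrightarrow> 0 < n \<Longrightarrow> degree (code_poly c) < n"
  by (metis carrier_vecD coeff_code_poly degree_0 leading_coeff_0_iff)

lemma code_poly_vec: "0 < n \<Longrightarrow> degree p < n \<Longrightarrow> code_poly (vec n (coeff p)) = p"
  by (intro poly_eqI) (simp add: coeff_code_poly coeff_eq_0)

lemma code_poly_add:
  "c \<in> carrier_vec n \<Longrightarrow> v \<in> carrier_vec n \<Longrightarrow> code_poly (c + v) = code_poly c + code_poly v"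
  by (intro poly_eqI) (simp add: coeff_code_poly)

lemma code_poly_minus:
  "c \<in> carrier_vec n \<Longrightarrow> v \<in> carrier_vec n \<Longrightarrow>
     code_poly (c - v) = code_poly c - code_poly (v :: 'a :: ab_group_add vec)"
  by (intro poly_eqI) (simp add: coeff_code_poly)

lemma code_poly_smult: "code_poly (a \<cdot>\<^sub>v c) = Polynomial.smult a (code_poly (c :: 'a :: comm_semiring_1 vec))"
  by (intro poly_eqI) (simp add: coeff_code_poly)

lemma code_poly_zero: "code_poly (0\<^sub>v n) = 0"
  by (intro poly_eqI) (simp add: coeff_code_poly)

lemma code_poly_eqD:
  assumes "code_poly c = code_poly v" and "c \<in> carrier_vec n" and "v \<in> carrier_vec n"
  shows "c = v"
proof (rule eq_vecI)
  fix i assume "i < dim_vec v"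
  then show "c $ i = v $ i"
    using assms coeff_code_poly[of c i] coeff_code_poly[of v i] by (simp)
qed (use assms in simp)

lemma poly_code_poly:
  fixes c :: "'a :: comm_semiring_1 vec"
  assumes "c \<in> carrier_vec n"
  shows "poly (code_poly c) x = (\<Sum>i<n. c $ i * x ^ i)"
proof -
  have *: "coeff (code_poly c) i = 0" if "n \<le> i" for i
    using assms that by (simp add: coeff_code_poly)
  have "poly (code_poly c) x = (\<Sum>i\<le>degree (code_poly c). coeff (code_poly c) i * x ^ i)"
    by (rule poly_altdef)
  also have "\<dots> = (\<Sum>i<n. coeff (code_poly c) i * x ^ i)"
    using assms by (intro sum.mono_neutral_cong)
      (auto simp: * not_le not_less coeff_eq_0)
  also have "\<dots> = (\<Sum>i<n. c $ i * x ^ i)"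
    using assms by (intro sum.cong) (auto simp: coeff_code_poly)
  finally show ?thesis .
qed

lemma degree_monom_plus_one: "0 < n \<Longrightarrow> degree (monom 1 n + 1 :: 'a :: field poly) = n"
  by (subst degree_add_eq_left) (simp_all add: degree_monom_eq)

section \<open>Residue classes\<close>

lemma negacyclic_modulus_eq: "negacyclic_modulus n = {p :: 'a :: field poly. monom 1 n + 1 dvd p}"
  unfolding negacyclic_modulus_def
  by (subst cring.cgenideal_eq_genideal[OF class_cring.is_cring, symmetric])
    (auto simp: cgenideal_def dvd_def mult.commute)

lemma ideal_negacyclic_modulus: "ideal (negacyclic_modulus n) (class_ring :: 'a :: field poly ring)"
  unfolding negacyclic_modulus_def by (rule ring.genideal_ideal[OF class_ring.ring_axioms]) simp

lemma cring_negacyclic_ring: "cring (negacyclic_ring n :: 'a :: field poly set ring)"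
  unfolding negacyclic_ring_def
  by (rule ideal.quotient_is_cring[OF ideal_negacyclic_modulus class_cring.is_cring])

lemma residue_class_eq_iff:
  "residue_class n p = residue_class n (q :: 'a :: field poly) \<longleftrightarrow> monom 1 n + 1 dvd p - q"
  using ring.quotient_eq_iff_same_a_r_cos[OF class_ring.ring_axioms ideal_negacyclic_modulus[of n], of p q]
  by (simp add: residue_class_def negacyclic_modulus_eq class_ring_simps)

lemma carrier_negacyclic_ring: "carrier (negacyclic_ring n) = range (residue_class n :: 'a :: field poly \<Rightarrow> _)"
  by (auto simp: negacyclic_ring_def residue_class_def FactRing_def A_RCOSETS_def' a_r_coset_def)

lemma mult_negacyclic_ring:
  "residue_class n p \<otimes>\<^bsub>negacyclic_ring n\<^esub> residue_class n q = residue_class n (p * q :: 'a :: field poly)"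
  using ideal.rcoset_mult_add[OF ideal_negacyclic_modulus[of n], of p q]
  by (simp add: negacyclic_ring_def residue_class_def FactRing_def)

lemma genideal_residue_class:
  "genideal (negacyclic_ring n) {residue_class n g} = range (\<lambda>p. residue_class n (p * g :: 'a :: field poly))"
proof -
  interpret cring "negacyclic_ring n :: 'a poly set ring" by (rule cring_negacyclic_ring)
  have "residue_class n g \<in> carrier (negacyclic_ring n)"
    by (simp add: carrier_negacyclic_ring)
  from cgenideal_eq_genideal[OF this, symmetric] show ?thesis
    by (auto simp: cgenideal_def carrier_negacyclic_ring simp flip: mult_negacyclic_ring)
qed

text \<open>A residue class has at most one representative of degree below \<open>n\<close>, because
  the modulus has degree \<open>n\<close>.\<close>

lemma code_residues_inj:
  fixes C D :: "'a :: field vec set"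
  assumes "0 < n" and "C \<subseteq> carrier_vec n" and "D \<subseteq> carrier_vec n"
    and "code_residues n C = code_residues n D"
  shows "C = D"
proof -
  have "inj_on (\<lambda>c :: 'a vec. residue_class n (code_poly c)) (carrier_vec n)"
  proof (rule inj_onI)
    fix c v :: "'a vec"
    assume cv: "c \<in> carrier_vec n" "v \<in> carrier_vec n"
      and "residue_class n (code_poly c) = residue_class n (code_poly v)"
    then have dvd: "monom 1 n + 1 dvd code_poly (c - v)"
      by (simp add: residue_class_eq_iff code_poly_minus)
    have "degree (code_poly (c - v)) < n" using cv assms(1) by (intro degree_code_poly) auto
    then have "code_poly (c - v) = 0"
      using dvd dvd_imp_degree_le[OF dvd] degree_monom_plus_one[OF assms(1), where 'a = 'a] by auto
    then show "c = v"
      using cv by (intro code_poly_eqD[of c v n]) (simp_all add: code_poly_minus)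
  qed
  then show ?thesis using assms(2-4) by (simp add: code_residues_def inj_on_image_eq_iff)
qed

section \<open>The code generated by a divisor of the modulus\<close>

lemma generated_code_carrier: "generated_code n g \<subseteq> carrier_vec n"
  by (auto simp: generated_code_def)

lemma code_residues_generated_code:
  fixes g :: "'a :: field poly"
  assumes "0 < n" and "g dvd monom 1 n + 1"
  shows "code_residues n (generated_code n g) = genideal (negacyclic_ring n) {residue_class n g}"
  unfolding genideal_residue_class
proof (intro equalityI subsetI)
  fix x assume "x \<in> code_residues n (generated_code n g)"
  then obtain c where "g dvd code_poly c" and xc: "x = residue_class n (code_poly c)"
    by (auto simp: code_residues_def generated_code_def)
  then obtain q where "code_poly c = g * q" by (elim dvdE)
  with xc have "x = residue_class n (q * g)" by (simp add: mult.commute)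
  then show "x \<in> range (\<lambda>p. residue_class n (p * g))" by blast
next
  fix x assume "x \<in> range (\<lambda>p. residue_class n (p * g))"
  then obtain p where x: "x = residue_class n (p * g)" by blast
  let ?M = "monom 1 n + 1 :: 'a poly"
  \<comment> \<open>Reduction gives a representative short enough to be a word; it remains a
    multiple of \<open>g\<close> because \<open>g\<close> divides the modulus.\<close>
  define r where "r = p * g mod ?M"
  have M: "degree ?M = n" by (rule degree_monom_plus_one[OF assms(1)])
  then have M0: "?M \<noteq> 0" using assms(1) by (metis degree_0 less_irrefl)
  have "degree r < n"
    using degree_mod_less[OF M0, of "p * g"] M assms(1) by (auto simp: r_def)
  then have "code_poly (vec n (coeff r)) = r" using assms(1) by (intro code_poly_vec) auto
  moreover have "g dvd r" unfolding r_def using assms(2) by (simp add: dvd_mod)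
  moreover have "x = residue_class n r"
    unfolding x residue_class_eq_iff r_def by (rule dvd_minus_mod)
  ultimately show "x \<in> code_residues n (generated_code n g)"
    by (auto simp: code_residues_def generated_code_def intro!: image_eqI[of _ _ "vec n (coeff r)"])
qed

lemma subspace_generated_code:
  "VectorSpace.subspace class_ring (generated_code n g) (module_vec TYPE('a :: field) n)"
proof (rule VectorSpace.subspace.intro)
  show "vectorspace class_ring (module_vec TYPE('a) n)" by (rule vec_vs)
  show "submodule class_ring (generated_code n g) (module_vec TYPE('a) n)"
  proof (rule submodule.intro)
    show "module class_ring (module_vec TYPE('a) n)" by (rule vec_module)
  qed (auto simp: generated_code_def module_vec_simps code_poly_add code_poly_smult code_poly_zero dvd_smult)
qed

lemma linear_code_generated_code: "linear_code n (generated_code n g)"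
  unfolding linear_code_def by (rule subspace_generated_code)

text \<open>Uniqueness in the definite description rests on two injectivities: that of the embedding
  on polynomials fixes the generator, and \<open>code_residues_inj\<close> then fixes the
  code.\<close>

lemma negacyclic_code_of_eq:
  fixes \<beta> :: "'f :: field"
  assumes "field_hom (gf3_embed :: gf3 \<Rightarrow> 'f)" and "0 < n" and "lead_coeff g = 1"
    and "g dvd monom 1 n + 1" and map: "map_poly gf3_embed g = (\<Prod>i\<in>Z. [:- (\<beta> ^ i), 1:])"
  shows "negacyclic_code_of n \<beta> Z = generated_code n g"
  unfolding negacyclic_code_of_def
proof (rule the_equality)
  interpret e: field_hom "gf3_embed :: gf3 \<Rightarrow> 'f" by fact
  interpret pe: map_poly_inj_idom_hom "gf3_embed :: gf3 \<Rightarrow> 'f" ..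
  interpret N: cring "negacyclic_ring n :: gf3 poly set ring" by (rule cring_negacyclic_ring)
  have "residue_class n g \<in> carrier (negacyclic_ring n)" by (simp add: carrier_negacyclic_ring)
  then have "ideal (code_residues n (generated_code n g)) (negacyclic_ring n)"
    unfolding code_residues_generated_code[OF assms(2,4)] by (intro N.genideal_ideal) simp
  then show "negacyclic_code n (generated_code n g) \<and>
      (\<exists>h. generator_polynomial n (generated_code n g) h \<and>
           map_poly gf3_embed h = (\<Prod>i\<in>Z. [:- (\<beta> ^ i), 1:]))"
    using assms linear_code_generated_code code_residues_generated_code[OF assms(2,4)]
    by (auto simp: negacyclic_code_def generator_polynomial_def)
  fix C assume "negacyclic_code n C \<and>
    (\<exists>h. generator_polynomial n C h \<and> map_poly gf3_embed h = (\<Prod>i\<in>Z. [:- (\<beta> ^ i), 1:]))"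
  then obtain h where C: "linear_code n C" "generator_polynomial n C h"
    and "map_poly gf3_embed h = (\<Prod>i\<in>Z. [:- (\<beta> ^ i), 1:])"
    by (auto simp: negacyclic_code_def)
  with map have "h = g" by (metis pe.eq_iff)
  with C(2) have "code_residues n C = code_residues n (generated_code n g)"
    by (simp add: generator_polynomial_def code_residues_generated_code[OF assms(2,4)])
  moreover have "C \<subseteq> carrier_vec n"
    using C(1) submodule.subset unfolding linear_code_def VectorSpace.subspace_def
    by (fastforce simp: module_vec_simps)
  ultimately show "C = generated_code n g"
    using code_residues_inj[OF assms(2)] generated_code_carrier by blast
qed

text \<open>Multiplication by \<open>g\<close> encodes messages of length \<open>k\<close>; the
  degree condition makes the products fill exactly the length \<open>n\<close>.\<close>

lemma encoding_bij:
  fixes g :: "'a :: field poly"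
  assumes "degree g + k = n" and "0 < k" and "g \<noteq> 0"
  shows "bij_betw (\<lambda>h. vec n (coeff (code_poly h * g))) (carrier_vec k) (generated_code n g)"
proof -
  have n: "0 < n" using assms by simp
  have deg: "degree (code_poly h * g) < n" if "h \<in> carrier_vec k" for h
    using degree_mult_le[of "code_poly h" g] degree_code_poly[OF that assms(2)] assms(1) by simp
  show ?thesis
  proof (rule bij_betwI')
    fix h h' :: "'a vec" assume h: "h \<in> carrier_vec k" "h' \<in> carrier_vec k"
    show "vec n (coeff (code_poly h * g)) = vec n (coeff (code_poly h' * g)) \<longleftrightarrow> h = h'"
    proof
      assume "vec n (coeff (code_poly h * g)) = vec n (coeff (code_poly h' * g))"
      then have "code_poly h * g = code_poly h' * g"
        using code_poly_vec[OF n deg[OF h(1)]] code_poly_vec[OF n deg[OF h(2)]] by metis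
      then show "h = h'" using assms(3) code_poly_eqD h by auto
    qed simp
  next
    fix h :: "'a vec" assume "h \<in> carrier_vec k"
    then show "vec n (coeff (code_poly h * g)) \<in> generated_code n g"
      by (simp add: generated_code_def code_poly_vec[OF n deg])
  next
    fix c assume c: "c \<in> generated_code n g"
    then obtain q where q: "code_poly c = q * g"
      by (auto simp: generated_code_def dvd_def mult.commute)
    have "degree (code_poly c) < n" using c n by (auto simp: generated_code_def intro: degree_code_poly)
    then have "degree q < k"
      using assms by (cases "q = 0") (auto simp: q degree_mult_eq)
    then have "code_poly (vec k (coeff q)) = q" using assms(2) by (intro code_poly_vec) auto
    then have "code_poly c = code_poly (vec n (coeff (code_poly (vec k (coeff q)) * g)))"
      using q deg[of "vec k (coeff q)"] by (simp add: code_poly_vec[OF n])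
    then have "c = vec n (coeff (code_poly (vec k (coeff q)) * g))"
      using c by (intro code_poly_eqD) (auto simp: generated_code_def)
    then show "\<exists>h\<in>carrier_vec k. c = vec n (coeff (code_poly h * g))"
      by (intro bexI[of _ "vec k (coeff q)"]) auto
  qed
qed

lemma code_dim_generated_code:
  fixes g :: "'a :: field poly"
  assumes "degree g + k = n" and "0 < k" and "g \<noteq> 0"
  shows "code_dim n (generated_code n g) = k"
proof -
  let ?W = "(module_vec TYPE('a) n)\<lparr>carrier := generated_code n g\<rparr>"
  let ?f = "\<lambda>h. vec n (coeff (code_poly h * g)) :: 'a vec"
  interpret V: vec_space "TYPE('a)" k .
  interpret N: vec_space "TYPE('a)" n .
  have W: "vectorspace class_ring ?W"
    by (rule N.subspace_is_vs[OF subspace_generated_code])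
  have f: "?f \<in> LinearCombinations.module_hom class_ring (module_vec TYPE('a) k) ?W"
    using bij_betw_apply[OF encoding_bij[OF assms]]
    by (auto simp: LinearCombinations.module_hom_def module_vec_simps code_poly_add code_poly_smult
        distrib_right intro!: eq_vecI)
  have lin: "linear_map class_ring (module_vec TYPE('a) k) ?W ?f"
    unfolding linear_map_def mod_hom_def mod_hom_axioms_def
    using vec_vs W vectorspace.axioms(1) f by blast
  have "vectorspace.dim class_ring (module_vec TYPE('a) k) = vectorspace.dim class_ring ?W"
    using encoding_bij[OF assms]
    by (intro linear_map.dim_eq[OF lin V.fin_dim]) (auto simp: bij_betw_def module_vec_simps)
  then show ?thesis by (simp add: code_dim_def V.dim_is_n)
qed

section \<open>Self-duality by counting\<close>

lemma finite_carrier_vec: "finite (carrier_vec n :: 'a :: finite vec set)"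
proof (rule finite_subset)
  show "carrier_vec n \<subseteq> vec_of_list ` {xs :: 'a list. set xs \<subseteq> UNIV \<and> length xs = n}"
    by (auto intro!: image_eqI[of _ _ "list_of_vec _"] simp: vec_list)
qed (intro finite_imageI finite_lists_length_eq finite)

text \<open>
  A word orthogonal to all shifts of the monic \<open>g\<close> satisfies a linear recurrence of order
  \<open>degree g\<close>.
\<close>

lemma dual_generated_code_determined:
  fixes g :: "'a :: field poly"
  assumes "lead_coeff g = 1" and "degree g \<le> n"
  shows "inj_on (\<lambda>v. vec (degree g) (\<lambda>i. v $ i)) (dual_code n (generated_code n g))"
proof (rule inj_onI)
  fix v v' assume v: "v \<in> dual_code n (generated_code n g)" "v' \<in> dual_code n (generated_code n g)"
    and eq: "vec (degree g) (\<lambda>i. v $ i) = vec (degree g) (\<lambda>i. v' $ i)"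
  have car: "v \<in> carrier_vec n" "v' \<in> carrier_vec n" using v by (auto simp: dual_code_def)
  have "i < n \<Longrightarrow> v $ i = v' $ i" for i
  proof (induction i rule: less_induct)
    case (less i)
    show ?case
    proof (cases "i < degree g")
      case True
      then show ?thesis using eq by (metis index_vec)
    next
      case False
      define s where "s = i - degree g"
      \<comment> \<open>The shift of \<open>g\<close> whose leading coefficient 1 sits at position
        \<open>i\<close>; pairing with it determines entry \<open>i\<close> from the earlier
        entries.\<close>
      define c where "c = vec n (coeff (monom 1 s * g))"
      have g0: "g \<noteq> 0" using assms(1) by auto
      have "degree (monom 1 s * g) = i"
        using False g0 by (simp add: s_def degree_mult_eq degree_monom_eq monom_eq_0_iff)
      then have "code_poly c = monom 1 s * g"
        unfolding c_def using less.prems by (intro code_poly_vec) auto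
      then have "c \<in> generated_code n g" by (simp add: generated_code_def c_def)
      then have "v \<bullet> c = v' \<bullet> c" using v by (simp add: dual_code_def)
      then have "(\<Sum>p\<in>{0..<n}. (v $ p - v' $ p) * coeff (monom 1 s * g) p) = 0"
        by (simp add: scalar_prod_def c_def left_diff_distrib sum_subtractf)
      also have "(\<Sum>p\<in>{0..<n}. (v $ p - v' $ p) * coeff (monom 1 s * g) p)
          = (\<Sum>p\<in>{i}. (v $ p - v' $ p) * coeff (monom 1 s * g) p)"
      proof (rule sum.mono_neutral_right)
        show "\<forall>p\<in>{0..<n} - {i}. (v $ p - v' $ p) * coeff (monom 1 s * g) p = 0"
        proof
          fix p assume "p \<in> {0..<n} - {i}"
          then consider "p < i" "p < n" | "p > i" by force
          then show "(v $ p - v' $ p) * coeff (monom 1 s * g) p = 0"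
            by cases (use less.IH[of p] \<open>degree (monom 1 s * g) = i\<close> in \<open>auto simp: coeff_eq_0\<close>)
        qed
      qed (use less.prems in auto)
      also have "coeff (monom 1 s * g) i = 1"
        using assms(1) False by (simp add: coeff_monom_mult s_def)
      then have "(\<Sum>p\<in>{i}. (v $ p - v' $ p) * coeff (monom 1 s * g) p) = v $ i - v' $ i" by simp
      finally show ?thesis by simp
    qed
  qed
  then show "v = v'" using car by (intro eq_vecI) auto
qed

text \<open>The dual has at most as many words as there are vectors of length
  \<open>degree g\<close>, and the code has exactly that many since
  \<open>n - degree g = degree g\<close>. The inclusion is therefore an equality.\<close>

lemma self_dual_generated_code:
  fixes g :: "'a :: {field, finite} poly"
  assumes "lead_coeff g = 1" and "2 * degree g = n" and "0 < n"
    and "generated_code n g \<subseteq> dual_code n (generated_code n g)"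
  shows "self_dual n (generated_code n g)"
proof -
  let ?C = "generated_code n g"
  have fin: "finite (dual_code n ?C)"
    by (rule finite_subset[OF _ finite_carrier_vec[of n]]) (auto simp: dual_code_def)
  have "card (dual_code n ?C) = card ((\<lambda>v. vec (degree g) (\<lambda>i. v $ i)) ` dual_code n ?C)"
    using assms(1,2) by (intro card_image[symmetric] dual_generated_code_determined) auto
  also have "\<dots> \<le> card (carrier_vec (degree g) :: 'a vec set)"
    by (intro card_mono finite_carrier_vec) auto
  also have "\<dots> = card ?C"
    using assms(1-3) by (intro bij_betw_same_card[OF encoding_bij]) auto
  finally have "?C = dual_code n ?C" using assms(4) fin by (intro card_seteq) auto
  then show ?thesis by (simp add: self_dual_def)
qed

section \<open>Spectra over an extension of GF(3)\<close>

locale gf3_extension =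
  fixes \<beta> :: "'f :: {finite, field}" and m n :: nat
  assumes n_eq: "n = (3 ^ m - 1) div 2" and m_pos: "0 < m" and card_field: "CARD('f) = 3 ^ m" and primitive: "primitive_element \<beta>"
begin

text \<open>The order \<open>3 ^ m - 1\<close> of the multiplicative group, in a form free of
  division and truncated subtraction.\<close>

abbreviation N :: nat where "N \<equiv> 2 * n"

lemma three_power_m: "3 ^ m = N + 1"
proof -
  have "even (3 ^ m - 1 :: nat)" by simp
  then have "3 ^ m - 1 = N" unfolding n_eq by simp
  then show ?thesis by (metis Suc_eq_plus1 Suc_pred' zero_less_numeral zero_less_power)
qed

lemma n_pos: "0 < n"
proof -
  have "(3::nat) ^ 1 \<le> 3 ^ m" using m_pos by (intro power_increasing) auto
  then show ?thesis using three_power_m by simp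
qed

lemma three_eq_0: "(3 :: 'f) = 0"
proof -
  have "(of_nat (3 ^ m) :: 'f) = 0" using of_nat_CARD_eq_0[where 'f = 'f] card_field by simp
  then show ?thesis by simp
qed

text \<open>In the field 2 n + 1 = 3^m = 0, so n = 0 would give 1 = 0.\<close>

lemma of_nat_n_neq_0: "(of_nat n :: 'f) \<noteq> 0"
proof
  assume *: "(of_nat n :: 'f) = 0"
  have "(of_nat (3 ^ m) :: 'f) = of_nat (2 * n + 1)" by (simp only: three_power_m)
  also have "\<dots> = 2 * of_nat n + 1" by (simp only: of_nat_add of_nat_mult) simp
  finally show False using * three_eq_0 m_pos by (simp add: power_0_left)
qed

lemma beta_neq_0 [simp]: "\<beta> \<noteq> 0"
  using primitive by (simp add: primitive_element_def)

lemma beta_N: "\<beta> ^ N = 1"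
  using primitive_element_order(1)[OF primitive] unfolding card_field three_power_m by simp

lemma beta_inj: "\<beta> ^ i = \<beta> ^ k \<Longrightarrow> i < N \<Longrightarrow> k < N \<Longrightarrow> i = k"
  using primitive_element_order(2)[OF primitive]
  unfolding card_field three_power_m by (auto dest: inj_onD)

text \<open>\<open>\<beta> ^ n\<close> is a square root of 1 and differs from 1 because
  \<open>\<beta>\<close> has order \<open>N > n\<close>.\<close>

lemma beta_n: "\<beta> ^ n = - 1"
proof -
  have "(\<beta> ^ n) ^ 2 = \<beta> ^ N" unfolding power_mult[symmetric] by (simp only: mult.commute)
  then have "(\<beta> ^ n)\<^sup>2 = 1" by (simp only: beta_N)
  moreover have "n < N" "0 < N" using n_pos by linarith+
  then have "\<beta> ^ n \<noteq> 1" using beta_inj[of n 0] n_pos by (metis power_0 less_irrefl)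
  ultimately show ?thesis by (simp add: power2_eq_1_iff)
qed

sublocale embed: field_hom "gf3_embed :: gf3 \<Rightarrow> 'f"
  by (rule field_hom_gf3_embed[OF three_eq_0])

text \<open>The Fourier transform of a word, that is, the values of its polynomial at the powers of
  \<open>\<beta>\<close>.\<close>

definition spectrum :: "gf3 vec \<Rightarrow> nat \<Rightarrow> 'f" where
  "spectrum c i = (\<Sum>p<n. gf3_embed (c $ p) * \<beta> ^ (i * p))"

lemma poly_map_code_poly:
  assumes "c \<in> carrier_vec n"
  shows "poly (map_poly gf3_embed (code_poly c)) (\<beta> ^ i) = spectrum c i"
proof -
  have "map_poly gf3_embed (code_poly c) = code_poly (map_vec gf3_embed c :: 'f vec)"
    by (intro poly_eqI) (simp add: coeff_code_poly)
  then show ?thesis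
    using assms poly_code_poly[of "map_vec gf3_embed c :: 'f vec" n]
    by (simp add: spectrum_def flip: power_mult)
qed

text \<open>The terms are odd powers of \<open>y = \<beta> ^ p / \<beta> ^ q\<close>, so the sum is
  \<open>y\<close> times a geometric series in \<open>y\<^sup>2\<close>. It vanishes for distinct
  \<open>p\<close> and \<open>q\<close>, since \<open>y\<^sup>2\<close> is then an
  \<open>n\<close>-th root of unity other than 1.\<close>

lemma geometric_orthogonality:
  assumes "p < n" and "q < n"
  shows "(\<Sum>t<n. \<beta> ^ ((2 * t + 1) * p) * \<beta> ^ ((N - (2 * t + 1)) * q)) = (if p = q then of_nat n else 0)"
proof -
  define y where "y = \<beta> ^ p / \<beta> ^ q"
  have B: "\<beta> ^ (a * b) = (\<beta> ^ b) ^ a" for a b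
    by (subst mult.commute) (rule power_mult)
  have "\<beta> ^ ((2 * t + 1) * p) * \<beta> ^ ((N - (2 * t + 1)) * q) = y * (y\<^sup>2) ^ t" if "t < n" for t
  proof -
    have "2 * t + 1 \<le> N" using that by linarith
    then have "(N - (2 * t + 1)) * q + (2 * t + 1) * q = N * q"
      by (simp only: le_add_diff_inverse2 flip: add_mult_distrib)
    then have "\<beta> ^ ((N - (2 * t + 1)) * q) * \<beta> ^ ((2 * t + 1) * q) = (\<beta> ^ N) ^ q"
      by (simp only: flip: power_add power_mult)
    then have "\<beta> ^ ((N - (2 * t + 1)) * q) * (\<beta> ^ q) ^ (2 * t + 1) = 1"
      by (simp only: beta_N power_one B[of "2 * t + 1" q])
    then have "\<beta> ^ ((N - (2 * t + 1)) * q) = 1 / (\<beta> ^ q) ^ (2 * t + 1)"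
      by (subst nonzero_eq_divide_eq) simp_all
    then have "\<beta> ^ ((2 * t + 1) * p) * \<beta> ^ ((N - (2 * t + 1)) * q) = y ^ (2 * t + 1)"
      by (simp only: y_def power_divide B[of "2 * t + 1" p]) simp
    then show ?thesis by (simp add: power_mult)
  qed
  then have sum: "(\<Sum>t<n. \<beta> ^ ((2 * t + 1) * p) * \<beta> ^ ((N - (2 * t + 1)) * q)) = y * (\<Sum>t<n. (y\<^sup>2) ^ t)"
    by (simp add: sum_distrib_left)
  show ?thesis
  proof (cases "p = q")
    case True
    then show ?thesis unfolding sum y_def by simp
  next
    case False
    have "y\<^sup>2 \<noteq> 1"
    proof
      assume "y\<^sup>2 = 1"
      then have "\<beta> ^ (2 * p) = \<beta> ^ (2 * q)"
        by (simp add: y_def power_divide mult.commute[of 2] power_mult)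
      then show False using beta_inj[of "2 * p" "2 * q"] assms False by linarith
    qed
    moreover have "(y\<^sup>2) ^ n = 1"
    proof -
      have "(y\<^sup>2) ^ n = y ^ N" by (rule power_mult[symmetric])
      also have "\<dots> = (\<beta> ^ N) ^ p / (\<beta> ^ N) ^ q"
        unfolding y_def power_divide power_mult[symmetric] by (simp only: mult.commute)
      finally show ?thesis by (simp only: beta_N power_one) simp
    qed
    ultimately show ?thesis using False unfolding sum by (simp add: geometric_sum)
  qed
qed

text \<open>Summing over \<open>t\<close> first leaves only the diagonal terms \<open>p = q\<close>.
  As \<open>n\<close> is invertible in the field, orthogonality can be read off from the
  spectra.\<close>

lemma parseval:
  assumes "c \<in> carrier_vec n" and "v \<in> carrier_vec n"
  shows "(\<Sum>t<n. spectrum c (2 * t + 1) * spectrum v (N - (2 * t + 1))) = of_nat n * gf3_embed (c \<bullet> v)"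
proof -
  let ?e = "gf3_embed :: gf3 \<Rightarrow> 'f"
  have "(\<Sum>t<n. spectrum c (2 * t + 1) * spectrum v (N - (2 * t + 1)))
      = (\<Sum>t<n. \<Sum>p<n. \<Sum>q<n. ?e (c $ p) * ?e (v $ q) *
          (\<beta> ^ ((2 * t + 1) * p) * \<beta> ^ ((N - (2 * t + 1)) * q)))"
    unfolding spectrum_def sum_product by (intro sum.cong refl) (simp only: ac_simps)
  also have "\<dots> = (\<Sum>p<n. \<Sum>t<n. \<Sum>q<n. ?e (c $ p) * ?e (v $ q) *
          (\<beta> ^ ((2 * t + 1) * p) * \<beta> ^ ((N - (2 * t + 1)) * q)))"
    by (rule sum.swap)
  also have "\<dots> = (\<Sum>p<n. \<Sum>q<n. \<Sum>t<n. ?e (c $ p) * ?e (v $ q) *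
          (\<beta> ^ ((2 * t + 1) * p) * \<beta> ^ ((N - (2 * t + 1)) * q)))"
    by (intro sum.cong refl sum.swap)
  also have "\<dots> = (\<Sum>p<n. \<Sum>q<n. if p = q then of_nat n * (?e (c $ p) * ?e (v $ q)) else 0)"
    by (intro sum.cong refl) (simp only: geometric_orthogonality lessThan_iff flip: sum_distrib_left, simp)
  also have "\<dots> = (\<Sum>p<n. of_nat n * ?e (c $ p * v $ p))"
    by (simp add: embed.hom_mult)
  also have "\<dots> = of_nat n * ?e (c \<bullet> v)"
    using assms by (simp add: scalar_prod_def embed.hom_sum sum_distrib_left atLeast0LessThan)
  finally show ?thesis .
qed

text \<open>
  The BCH argument: pairing a word with the product of \<open>X - \<beta> ^ (s * q)\<close> over all but one position
  of its support isolates one coordinate.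
\<close>

lemma BCH_bound:
  assumes c: "c \<in> carrier_vec n" and "c \<noteq> 0\<^sub>v n"
    and inj: "inj_on (\<lambda>p. \<beta> ^ (s * p)) {..<n}"
    and zero: "\<And>t. t < L \<Longrightarrow> spectrum c (b + t * s) = 0"
  shows "L < card {p. p < n \<and> c $ p \<noteq> 0}"
proof (rule ccontr)
  define S where "S = {p. p < n \<and> c $ p \<noteq> 0}"
  assume "\<not> L < card {p. p < n \<and> c $ p \<noteq> 0}"
  then have L: "card S \<le> L" by (simp add: S_def)
  have fin: "finite S" by (simp add: S_def)
  have "\<exists>p<n. c $ p \<noteq> 0" using c assms(2) by (metis carrier_vecD eq_vecI index_zero_vec)
  then obtain p where p: "p \<in> S" by (auto simp: S_def)
  \<comment> \<open>Its degree is one less than the weight, hence below \<open>L\<close>, so only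
    vanishing spectral values enter the pairing.\<close>
  define f where "f = (\<Prod>q\<in>S - {p}. [:- (\<beta> ^ (s * q)), 1:])"
  have "degree f = card (S - {p})"
    unfolding f_def by (subst degree_prod_eq_sum_degree) auto
  then have deg: "degree f < L" using L fin p by (metis card_Diff1_less order_less_le_trans)
  let ?a = "\<lambda>q. gf3_embed (c $ q) * \<beta> ^ (b * q)"
  have "(\<Sum>q<n. ?a q * poly f (\<beta> ^ (s * q))) = (\<Sum>q<n. \<Sum>t\<le>degree f. coeff f t * (?a q * \<beta> ^ (t * s * q)))"
    unfolding poly_altdef sum_distrib_left
    by (intro sum.cong refl) (simp add: ac_simps flip: power_mult)
  also have "\<dots> = (\<Sum>t\<le>degree f. \<Sum>q<n. coeff f t * (?a q * \<beta> ^ (t * s * q)))"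
    by (rule sum.swap)
  also have "\<dots> = (\<Sum>t\<le>degree f. coeff f t * spectrum c (b + t * s))"
    by (simp add: spectrum_def sum_distrib_left add_mult_distrib power_add mult.assoc)
  also have "\<dots> = 0" using zero deg by (intro sum.neutral) auto
  finally have "(\<Sum>q<n. ?a q * poly f (\<beta> ^ (s * q))) = 0" .
  moreover have "(\<Sum>q<n. ?a q * poly f (\<beta> ^ (s * q))) = (\<Sum>q\<in>{p}. ?a q * poly f (\<beta> ^ (s * q)))"
  proof (rule sum.mono_neutral_right)
    show "\<forall>q\<in>{..<n} - {p}. ?a q * poly f (\<beta> ^ (s * q)) = 0"
    proof
      fix q assume q: "q \<in> {..<n} - {p}"
      show "?a q * poly f (\<beta> ^ (s * q)) = 0"
      proof (cases "q \<in> S")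
        case True
        with q fin have "poly f (\<beta> ^ (s * q)) = 0"
          by (auto simp: f_def poly_prod intro!: bexI[of _ q])
        then show ?thesis by simp
      next
        case False
        with q show ?thesis by (simp add: S_def)
      qed
    qed
  qed (use p in \<open>auto simp: S_def\<close>)
  moreover have "poly f (\<beta> ^ (s * p)) \<noteq> 0"
    using fin p inj by (auto simp: f_def poly_prod S_def dest: inj_onD)
  ultimately show False using p by (simp add: S_def)
qed

text \<open>If positions \<open>p < q\<close> collide, then \<open>y = \<beta> ^ (q - p)\<close> is
  fixed by the \<open>r\<close>-th and the \<open>m\<close>-th power of Frobenius, hence by
  Frobenius itself. This gives \<open>y\<^sup>2 = 1\<close>, impossible because
  \<open>0 < 2 * (q - p) < N\<close>.\<close>

lemma power_order_coprime:
  assumes "coprime r m" and "0 < r"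
  shows "inj_on (\<lambda>p. \<beta> ^ ((3 ^ r - 1) * p)) {..<n}"
proof (rule linorder_inj_onI)
  fix p q assume pq: "p < q" "p \<in> {..<n}" "q \<in> {..<n}"
  then have "q < n" by simp
  show "\<beta> ^ ((3 ^ r - 1) * p) \<noteq> \<beta> ^ ((3 ^ r - 1) * q)"
  proof
    assume eq: "\<beta> ^ ((3 ^ r - 1) * p) = \<beta> ^ ((3 ^ r - 1) * q)"
    define y where "y = \<beta> ^ (q - p)"
    have y0: "y \<noteq> 0" by (simp add: y_def)
    have fix_pow: "z ^ (k ^ e) = z" if "z ^ k = z" for z :: 'f and k e :: nat
      by (induction e) (simp_all add: power_mult that)
    have "q = p + (q - p)" using pq by simp
    then have "\<beta> ^ ((3 ^ r - 1) * q) = \<beta> ^ ((3 ^ r - 1) * p) * y ^ (3 ^ r - 1)"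
      unfolding y_def power_mult[symmetric] power_add[symmetric]
      by (simp only: mult.commute[of "q - p"] flip: distrib_left)
    with eq have "y ^ (3 ^ r - 1) = 1" by simp
    then have r: "y ^ (3 ^ r) = y"
      using power_minus_mult[of "3 ^ r" y] by simp
    have "y ^ N = (\<beta> ^ N) ^ (q - p)"
      unfolding y_def power_mult[symmetric] by (simp only: mult.commute)
    then have "y ^ N = 1" by (simp only: beta_N power_one)
    then have m: "y ^ (3 ^ m) = y" by (simp add: three_power_m)
    obtain u v where uv: "r * u = m * v + 1"
      using bezout_nat[of r m] assms by auto
    \<comment> \<open>By Bezout, \<open>r * u\<close> Frobenius steps exceed \<open>m * v\<close>
      steps by one; both numbers of steps fix \<open>y\<close>, so the single extra step does
      too.\<close>
    have "y = y ^ ((3 ^ r) ^ u)" using fix_pow[OF r] by simp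
    also have "(3 ^ r) ^ u = (3 ^ m) ^ v * (3 :: nat)" by (simp add: uv flip: power_mult power_add)
    also have "y ^ ((3 ^ m) ^ v * 3) = y ^ 3" by (simp add: power_mult fix_pow[OF m])
    finally have "y * 1 = y * y\<^sup>2" by (simp add: power3_eq_cube power2_eq_square)
    then have "y\<^sup>2 = 1" using y0 by (metis mult_left_cancel)
    then have "\<beta> ^ (2 * (q - p)) = \<beta> ^ 0" by (simp add: y_def mult.commute flip: power_mult)
    then have "2 * (q - p) = 0"
      by (rule beta_inj) (use pq(1) \<open>q < n\<close> in linarith)+
    then show False using pq(1) by simp
  qed
qed auto

end

section \<open>Codes with a self-dual defining set\<close>

text \<open>Invariance under multiplication by 3 lets the generator descend to GF(3); containing
  exactly one of \<open>i\<close> and \<open>N - i\<close> gives self-orthogonality and the right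
  dimension.\<close>

locale self_dual_defining_set = gf3_extension \<beta> m n
  for \<beta> :: "'f :: {finite, field}" and m n :: nat +
  fixes Z :: "nat set"
  assumes Z_subset: "Z \<subseteq> {i. odd i \<and> i < N}"
    and Z_rotate: "i \<in> Z \<Longrightarrow> \<exists>k\<in>Z. \<beta> ^ (3 * i) = \<beta> ^ k"
    and Z_complement: "odd i \<Longrightarrow> i < N \<Longrightarrow> N - i \<in> Z \<longleftrightarrow> i \<notin> Z"
begin

lemma finite_Z: "finite Z"
  by (rule finite_subset[OF Z_subset]) simp

text \<open>Negation modulo \<open>N\<close> permutes the \<open>n\<close> odd residues and
  exchanges \<open>Z\<close> with its complement among them.\<close>

lemma card_Z: "2 * card Z = n"
proof -
  have odds: "{i. odd i \<and> i < N} = (\<lambda>t. 2 * t + 1) ` {..<n}"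
  proof (intro equalityI subsetI)
    fix i assume "i \<in> {i. odd i \<and> i < N}"
    then obtain t where "i = 2 * t + 1" "i < N" by (auto elim: oddE)
    then show "i \<in> (\<lambda>t. 2 * t + 1) ` {..<n}" by auto
  qed auto
  have "{i. odd i \<and> i < N} = Z \<union> (\<lambda>i. N - i) ` Z"
  proof (intro equalityI subsetI)
    fix i assume i: "i \<in> {i. odd i \<and> i < N}"
    show "i \<in> Z \<union> (\<lambda>i. N - i) ` Z"
    proof (cases "i \<in> Z")
      case False
      then have "N - i \<in> Z" using Z_complement i by blast
      moreover have "i = N - (N - i)" using i by simp
      ultimately show ?thesis by blast
    qed simp
  next
    fix i assume "i \<in> Z \<union> (\<lambda>i. N - i) ` Z"
    then consider "i \<in> Z" | k where "k \<in> Z" "i = N - k" by blast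
    then show "i \<in> {i. odd i \<and> i < N}"
    proof cases
      case 2
      then have "odd k" "k < N" using Z_subset by auto
      then show ?thesis using 2 by (auto simp: odd_pos)
    qed (use Z_subset in blast)
  qed
  moreover have "Z \<inter> (\<lambda>i. N - i) ` Z = {}"
    using Z_complement Z_subset by blast
  moreover have "card ((\<lambda>i. N - i) ` Z) = card Z"
    using Z_subset by (intro card_image inj_onI) (metis (no_types, lifting) diff_diff_cancel less_imp_le mem_Collect_eq subsetD)
  moreover have "card {i. odd i \<and> i < N} = n"
    unfolding odds by (subst card_image) (auto intro: inj_onI)
  ultimately show ?thesis using finite_Z by (simp add: card_Un_disjoint)
qed

lemma beta_inj_on_Z: "inj_on (\<lambda>i. \<beta> ^ i) Z"
proof (rule inj_onI)
  fix i k assume "i \<in> Z" "k \<in> Z" and eq: "\<beta> ^ i = \<beta> ^ k"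
  then have "i < N" "k < N" using Z_subset by auto
  with eq show "i = k" by (rule beta_inj)
qed

abbreviation Z_poly :: "'f poly" where
  "Z_poly \<equiv> \<Prod>i\<in>Z. [:- (\<beta> ^ i), 1:]"

lemma Z_poly_roots: "Z_poly = (\<Prod>a\<in>(\<lambda>i. \<beta> ^ i) ` Z. [:- a, 1:])"
  by (simp add: prod.reindex[OF beta_inj_on_Z])

text \<open>
  Cubing permutes the roots \<open>\<beta> ^ i\<close>, so the coefficients of their product are fixed by the
  Frobenius automorphism.
\<close>

lemma Z_poly_cube: "map_poly (\<lambda>x. x ^ 3) Z_poly = Z_poly"
proof -
  let ?A = "(\<lambda>i. \<beta> ^ i) ` Z"
  interpret c: field_hom "\<lambda>x :: 'f. x ^ 3" by (rule field_hom_cube[OF three_eq_0])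
  interpret pc: map_poly_comm_ring_hom "\<lambda>x :: 'f. x ^ 3" ..
  have "(\<lambda>x. x ^ 3) ` ?A \<subseteq> ?A"
  proof safe
    fix i assume "i \<in> Z"
    from Z_rotate[OF this] show "(\<beta> ^ i) ^ 3 \<in> ?A" by (auto simp: mult.commute simp flip: power_mult)
  qed
  moreover have inj: "inj_on (\<lambda>x. x ^ 3) ?A" by (intro inj_onI) simp
  ultimately have perm: "(\<lambda>x. x ^ 3) ` ?A = ?A"
    using finite_Z by (intro endo_inj_surj) auto
  have "map_poly (\<lambda>x. x ^ 3) Z_poly = (\<Prod>a\<in>?A. [:- (a ^ 3), 1:])"
    unfolding Z_poly_roots pc.hom_prod by (intro prod.cong refl) (simp add: map_poly_pCons)
  also have "\<dots> = (\<Prod>b\<in>(\<lambda>x. x ^ 3) ` ?A. [:- b, 1:])"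
    by (simp add: prod.reindex[OF inj])
  finally show ?thesis unfolding perm Z_poly_roots .
qed

definition generator :: "gf3 poly" where
  "generator = (SOME g. map_poly gf3_embed g = Z_poly)"

lemma map_generator: "map_poly gf3_embed generator = Z_poly"
proof -
  obtain g :: "gf3 poly" where "map_poly gf3_embed g = Z_poly"
    by (rule map_poly_gf3_embedE[OF three_eq_0 Z_poly_cube])
  then show ?thesis unfolding generator_def by (rule someI)
qed

lemma degree_generator: "degree generator = card Z"
proof -
  have "degree generator = degree Z_poly" using map_generator by (metis embed.degree_map_poly_hom)
  also have "\<dots> = card Z" by (subst degree_prod_eq_sum_degree) auto
  finally show ?thesis .
qed

lemma monic_generator: "lead_coeff generator = 1"
proof -
  have "gf3_embed (lead_coeff generator) = lead_coeff Z_poly"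
    using map_generator by (metis embed.hom_lead_coeff)
  also have "\<dots> = 1" by (simp add: lead_coeff_prod)
  finally show ?thesis by simp
qed

text \<open>Divisibility over GF(3) may be tested over the extension, where \<open>Z_poly\<close> is
  a product of distinct linear factors.\<close>

lemma generator_dvd_iff: "generator dvd p \<longleftrightarrow> (\<forall>i\<in>Z. poly (map_poly gf3_embed p) (\<beta> ^ i) = 0)"
proof -
  interpret pe: map_poly_comm_ring_hom "gf3_embed :: gf3 \<Rightarrow> 'f" ..
  have "generator dvd p \<longleftrightarrow> Z_poly dvd map_poly gf3_embed p"
    using embed.dvd_map_poly_hom_imp_dvd pe.hom_dvd map_generator by metis
  also have "\<dots> \<longleftrightarrow> (\<forall>i\<in>Z. poly (map_poly gf3_embed p) (\<beta> ^ i) = 0)"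
    unfolding Z_poly_roots using finite_Z by (subst prod_roots_dvd_iff) auto
  finally show ?thesis .
qed

lemma generator_dvd_modulus: "generator dvd monom 1 n + 1"
proof -
  interpret pe: map_poly_comm_ring_hom "gf3_embed :: gf3 \<Rightarrow> 'f" ..
  have "map_poly gf3_embed (monom 1 n + 1 :: gf3 poly) = (monom 1 n + 1 :: 'f poly)"
    by (simp add: pe.hom_add embed.map_poly_hom_monom)
  moreover have "(\<beta> ^ i) ^ n = -1" if "i \<in> Z" for i
  proof -
    have "(\<beta> ^ i) ^ n = (\<beta> ^ n) ^ i" by (simp add: mult.commute flip: power_mult)
    then show ?thesis using that Z_subset by (auto simp: beta_n)
  qed
  ultimately show ?thesis by (simp add: generator_dvd_iff poly_monom)
qed

section \<open>Self-duality, dimension and distance of the code\<close>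

abbreviation code :: "gf3 vec set" where
  "code \<equiv> generated_code n generator"

lemma negacyclic_code_of_Z: "negacyclic_code_of n \<beta> Z = code"
  using embed.field_hom_axioms n_pos monic_generator generator_dvd_modulus map_generator
  by (rule negacyclic_code_of_eq)

lemma code_iff: "c \<in> code \<longleftrightarrow> c \<in> carrier_vec n \<and> (\<forall>i\<in>Z. spectrum c i = 0)"
  unfolding generated_code_def by (auto simp: generator_dvd_iff poly_map_code_poly)

text \<open>One of \<open>2 * t + 1\<close> and its negative lies in \<open>Z\<close>, so every term
  of Parseval's sum has a vanishing factor.\<close>

lemma code_orthogonal:
  assumes "c \<in> code" and "v \<in> code"
  shows "c \<bullet> v = 0"
proof -
  have "spectrum c (2 * t + 1) * spectrum v (N - (2 * t + 1)) = 0" if "t < n" for t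
  proof -
    have "2 * t + 1 < N" using that by linarith
    then have "2 * t + 1 \<in> Z \<or> N - (2 * t + 1) \<in> Z" using Z_complement[of "2 * t + 1"] by auto
    then show ?thesis using assms by (auto simp: code_iff)
  qed
  then have "(\<Sum>t<n. spectrum c (2 * t + 1) * spectrum v (N - (2 * t + 1))) = 0"
    by (intro sum.neutral) blast
  then have "of_nat n * gf3_embed (c \<bullet> v) = (0 :: 'f)"
    using assms by (subst parseval[symmetric]) (simp_all only: code_iff)
  then show ?thesis using of_nat_n_neq_0 by simp
qed

lemma self_dual_code: "self_dual n code"
proof (rule self_dual_generated_code[OF monic_generator _ n_pos])
  show "2 * degree generator = n" by (simp add: degree_generator card_Z)
  show "code \<subseteq> dual_code n code"
    using code_orthogonal by (auto simp: dual_code_def code_iff)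
qed

lemma code_dim_code: "code_dim n code = n div 2"
proof (rule code_dim_generated_code)
  have half: "n div 2 = card Z" by (subst card_Z[symmetric]) simp
  show "degree generator + n div 2 = n" using card_Z by (simp add: degree_generator half)
  show "0 < n div 2" using card_Z n_pos unfolding half by simp
  show "generator \<noteq> 0" using monic_generator by auto
qed

text \<open>Nonzero elements of GF(3) have square 1, so \<open>c \<bullet> c\<close>, which is 0,
  counts the support modulo 3.\<close>

lemma weight_divisible:
  assumes "c \<in> code"
  shows "3 dvd card {p. p < n \<and> c $ p \<noteq> 0}"
proof -
  have "c $ p * c $ p = (if c $ p \<noteq> 0 then 1 else 0)" for p
    using gf3_square by simp
  moreover have "dim_vec c = n" using assms by (simp add: code_iff)
  ultimately have "c \<bullet> c = (\<Sum>p\<in>{0..<n}. if c $ p \<noteq> 0 then 1 else 0)"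
    by (simp only: scalar_prod_def)
  also have "\<dots> = of_nat (card {p. p < n \<and> c $ p \<noteq> 0})"
    by (simp add: sum.If_cases Int_def)
  finally show ?thesis
    using code_orthogonal[OF assms assms] by (simp add: of_nat_gf3_eq_0_iff)
qed

text \<open>A difference of codewords is a codeword, and the run of \<open>L\<close> zeros forces
  its weight above \<open>L\<close>. Both numbers are multiples of 3, so the weight is at least
  \<open>L + 3\<close>.\<close>

lemma min_distance_code:
  assumes inj: "inj_on (\<lambda>p. \<beta> ^ (s * p)) {..<n}"
    and run: "\<And>t. t < L \<Longrightarrow> b + t * s \<in> Z" and "3 dvd L"
  shows "L + 3 \<le> min_distance code"
proof -
  have bound: "L + 3 \<le> hamming_dist u v" if uv: "u \<in> code" "v \<in> code" "u \<noteq> v" for u v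
  proof -
    define c where "c = u - v"
    have car: "u \<in> carrier_vec n" "v \<in> carrier_vec n" using uv by (auto simp: code_iff)
    then have "c \<in> code"
      using uv by (simp add: c_def generated_code_def code_poly_minus)
    moreover have "c \<noteq> 0\<^sub>v n"
      using uv(3) car by (auto simp: c_def vec_eq_iff)
    ultimately have "L < card {p. p < n \<and> c $ p \<noteq> 0}" "3 dvd card {p. p < n \<and> c $ p \<noteq> 0}"
      using BCH_bound[OF _ _ inj, of c L b] run weight_divisible by (auto simp: code_iff)
    then have "L + 3 \<le> card {p. p < n \<and> c $ p \<noteq> 0}"
      using \<open>3 dvd L\<close> by presburger
    also have "{p. p < n \<and> c $ p \<noteq> 0} = {p. p < dim_vec u \<and> u $ p \<noteq> v $ p}"
      using car by (auto simp: c_def)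
    finally show ?thesis by (simp add: hamming_dist_def)
  qed
  let ?D = "{hamming_dist u v | u v. u \<in> code \<and> v \<in> code \<and> u \<noteq> v}"
  \<comment> \<open>The infimum is known to be attained only for a nonempty set of distances; zero
    and the generator provide two distinct words.\<close>
  have "generator \<noteq> 0" using monic_generator by auto
  moreover have dg: "degree generator < n" using card_Z n_pos by (simp add: degree_generator)
  ultimately have "vec n (coeff generator) \<in> code" "vec n (coeff generator) \<noteq> 0\<^sub>v n" "0\<^sub>v n \<in> code"
    using n_pos code_poly_vec[OF n_pos dg] code_poly_zero[of n, where 'a = gf3]
    by (auto simp: generated_code_def)
  then have "?D \<noteq> {}" by blast
  then have "Inf ?D \<in> ?D" by (rule Inf_nat_def1)
  then obtain u v where "min_distance code = hamming_dist u v" "u \<in> code" "v \<in> code" "u \<noteq> v"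
    unfolding min_distance_def by blast
  then show ?thesis using bound by simp
qed

end

section \<open>Unions of the sets \<open>T3\<close>\<close>

text \<open>Oddness comes from the parity of digit sums, invariance from digit rotation, and the
  splitting of \<open>i\<close> and \<open>N - i\<close> from digit complements together with the
  choice of one index per pair.\<close>

lemma self_dual_defining_set_union_T3:
  fixes \<beta> :: "'f :: {finite, field}" and j :: "nat \<Rightarrow> nat"
  assumes "0 < k" and "CARD('f) = 3 ^ (2 * k)" and "primitive_element \<beta>"
    and j: "\<And>i. i < k \<Longrightarrow> j i = i \<or> j i = 2 * k - 1 - i"
  shows "self_dual_defining_set \<beta> (2 * k) ((3 ^ (2 * k) - 1) div 2) (\<Union>l\<in>j ` {..<k}. T3 (2 * k) l)"
proof -
  let ?m = "2 * k"
  define n where "n = (3 ^ ?m - 1 :: nat) div 2"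
  interpret gf3_extension \<beta> ?m n
    using assms(1-3) by unfold_locales (simp_all add: n_def)
  have N: "3 ^ ?m - 1 = N" by (simp add: three_power_m)
  show ?thesis
    unfolding n_def[symmetric]
  proof unfold_locales
    show "(\<Union>l\<in>j ` {..<k}. T3 ?m l) \<subseteq> {i. odd i \<and> i < N}"
      using T3_odd[of _ ?m] T3_less[of _ ?m, unfolded N] by auto
  next
    fix i assume "i \<in> (\<Union>l\<in>j ` {..<k}. T3 ?m l)"
    then obtain l where l: "l \<in> j ` {..<k}" "i \<in> T3 ?m l" by blast
    obtain i' y where i': "i' \<in> T3 ?m l" "3 * i = i' + N * y"
      by (rule T3_rotate[OF m_pos l(2), unfolded N])
    have "\<beta> ^ (3 * i) = \<beta> ^ i' * (\<beta> ^ N) ^ y" unfolding i'(2) power_add power_mult ..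
    then have "\<beta> ^ (3 * i) = \<beta> ^ i'" by (simp only: beta_N power_one mult_1_right)
    then show "\<exists>i'\<in>(\<Union>l\<in>j ` {..<k}. T3 ?m l). \<beta> ^ (3 * i) = \<beta> ^ i'"
      using l(1) i'(1) by blast
  next
    fix i assume i: "odd i" "i < N"
    then obtain l where l: "l < ?m" "i \<in> T3 ?m l"
      using odd_in_T3[of i ?m, unfolded N] by blast
    have "N - i \<in> T3 ?m (?m - 1 - l)"
      using mem_T3_complement[of i ?m l, unfolded N] i l odd_pos by blast
    then have "N - i \<in> (\<Union>l\<in>j ` {..<k}. T3 ?m l) \<longleftrightarrow> ?m - 1 - l \<in> j ` {..<k}"
      using T3_disjoint by blast
    moreover have "i \<in> (\<Union>l\<in>j ` {..<k}. T3 ?m l) \<longleftrightarrow> l \<in> j ` {..<k}"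
      using T3_disjoint l(2) by blast
    ultimately show "N - i \<in> (\<Union>l\<in>j ` {..<k}. T3 ?m l) \<longleftrightarrow> i \<notin> (\<Union>l\<in>j ` {..<k}. T3 ?m l)"
      using choice_complement[OF j l(1)] by blast
  qed
qed

theorem theorem33:
  fixes m n d :: nat and j :: "nat \<Rightarrow> nat" and \<beta> :: "'f::{finite,field}"
    and Z :: "nat set" and C :: "gf3 vec set"
  assumes "m \<ge> 4" and "even m"
    and n: "n = (3 ^ m - 1) div 2"
    and "CARD('f) = 3 ^ m"
    and "primitive_element \<beta>"
    and j: "\<And>i. i \<le> (m - 2) div 2 \<Longrightarrow> j i \<in> {i, m - 1 - i}"
    and Z: "Z = (\<Union>i\<in>{0..(m - 2) div 2}. T3 m (j i))"
    and C: "C = negacyclic_code_of n \<beta> Z"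
    and d: "d = (if m mod 4 = 0 then 3 ^ ((m - 2) div 2) + 3 else 3 ^ ((m - 4) div 2) + 3)"
  shows "linear_code n C \<and> self_dual n C \<and>
         code_dim n C = (3 ^ m - 1) div 4 \<and> min_distance C \<ge> d"
proof -
  obtain k where m: "m = 2 * k" using \<open>even m\<close> by blast
  have k: "k \<ge> 2" using \<open>m \<ge> 4\<close> m by simp
  have "{0..(m - 2) div 2} = {..<k}" using m k by auto
  then have Z': "Z = (\<Union>l\<in>j ` {..<k}. T3 (2 * k) l)" using Z m by auto
  have j': "j i = i \<or> j i = 2 * k - 1 - i" if "i < k" for i
    using j[of i] that m by auto
  interpret self_dual_defining_set \<beta> m n Z
    using self_dual_defining_set_union_T3[of k \<beta> j] j' k assms(4,5) unfolding n m Z' by simp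
  have C': "C = code" unfolding C by (rule negacyclic_code_of_Z)
  \<comment> \<open>The progression is sought in the set chosen from the middle pair; it has
    \<open>3 ^ r\<close> terms with step \<open>3 ^ r - 1\<close>, and the top \<open>s\<close>
    digits are left to \<open>u\<close>.\<close>
  have dist: "3 ^ r + 3 \<le> min_distance code"
    if "coprime r m" "0 < r" "m = r + (r + s)" "u < 3 ^ s" "2 * r + wt3 s u = 1 + 2 * j (k - 1)"
    for r s u
  proof (rule min_distance_code)
    show "inj_on (\<lambda>p. \<beta> ^ ((3 ^ r - 1) * p)) {..<n}"
      using that(1,2) by (rule power_order_coprime)
    show "3 ^ r - 1 + 3 ^ r * 3 ^ r * u + t * (3 ^ r - 1) \<in> Z" if "t < 3 ^ r" for t
    proof -
      have "3 ^ r - 1 + 3 ^ r * 3 ^ r * u + t * (3 ^ r - 1) \<in> T3 m (j (k - 1))"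
        unfolding \<open>m = r + (r + s)\<close> by (rule progression_in_T3) fact+
      then show ?thesis using k unfolding Z' m[symmetric] by auto
    qed
    show "(3::nat) dvd 3 ^ r" using that(2) by (intro dvd_power) auto
  qed
  have middle: "j (k - 1) = k - 1 \<or> j (k - 1) = k" using j'[of "k - 1"] k by auto
  \<comment> \<open>In base 3 the numbers 1, 5 and 17 are 1, 12 and 122. Two free digits must sum to
    1 or 3 and four free digits to 3 or 5, according to whether \<open>j (k - 1)\<close> is
    \<open>k - 1\<close> or \<open>k\<close>.\<close>
  have wt3: "wt3 2 1 = 1" "wt3 2 5 = 3" "wt3 4 5 = 3" "wt3 4 17 = 5"
    by code_simp+
  have "d \<le> min_distance code"
  proof (cases "m mod 4 = 0")
    case True
    \<comment> \<open>Here \<open>k\<close> is even, so \<open>r\<close> is odd and adjacent to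
      \<open>k\<close>, hence coprime to \<open>m = 2 * k\<close>.\<close>
    define r where "r = k - 1"
    have "even k" using True unfolding m by presburger
    with k have r: "k = r + 1" "0 < r" "odd r" unfolding r_def by simp_all
    have "coprime r (2 * (r + 1))"
      unfolding coprime_mult_right_iff using r(3) by (simp add: coprime_right_2_iff_odd)
    then have "coprime r m" unfolding m r(1) .
    then have "3 ^ r + 3 \<le> min_distance code"
      using dist[of r 2 1] dist[of r 2 5] middle r wt3 by (auto simp: m)
    moreover have "(m - 2) div 2 = r" unfolding m r by simp
    ultimately show ?thesis unfolding d using True by simp
  next
    case False
    \<comment> \<open>For odd \<open>k\<close> the number \<open>k - 1\<close> would share the
      factor 2 with \<open>m\<close>, whereas the odd number \<open>k - 2\<close> is coprime to 2
      and to \<open>k\<close>.\<close>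
    define r where "r = k - 2"
    have "odd k" using False unfolding m by presburger
    with k have r: "k = r + 2" "0 < r" "odd r" unfolding r_def by (auto elim: oddE)
    have "coprime r 2" using r(3) by (simp add: coprime_right_2_iff_odd)
    moreover from this have "coprime r (r + 2)" unfolding coprime_iff_gcd_eq_1 gcd_add2 .
    ultimately have "coprime r (2 * (r + 2))" unfolding coprime_mult_right_iff by (rule conjI)
    then have "coprime r m" unfolding m r(1) .
    then have "3 ^ r + 3 \<le> min_distance code"
      using dist[of r 4 5] dist[of r 4 17] middle r wt3 by (auto simp: m)
    moreover have "(m - 4) div 2 = r" unfolding m r by simp
    ultimately show ?thesis unfolding d using False by simp
  qed
  moreover have "code_dim n code = (3 ^ m - 1) div 4"
    unfolding code_dim_code unfolding n by (simp flip: div_mult2_eq)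
  ultimately show ?thesis
    unfolding C' using linear_code_generated_code self_dual_code by blast
qed

end
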